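(* Let $\mathbb{F}$ be a field and let $\mathbf{L}=\mathbf{L}_0\oplus\mathbf{W}$ be an almost Abelian Lie algebra over $\mathbb{F}$, where $\mathbf{L}_0$ is an indecomposable almost Abelian Lie algebra and $\mathbf{W}$ is a possibly trivial Abelian Lie algebra. Then the group of Lie algebra automorphisms of $\mathbf{L}$ is $$\mathrm{Aut}(\mathbf{L})=\left\{\phi=\begin{pmatrix}\phi_{00}&\phi_{01}\\ \phi_{10}&\phi_{11}\end{pmatrix}\ \text{a surjective Lie algebra homomorphism }\mathbf{L}\to\mathbf{L}\;\middle|\;\phi_{00}\in\mathrm{Aut}(\mathbf{L}_0),\ \ker\phi_{11}=0\right\}.$$
   Context: An almost Abelian Lie algebra over a field $\mathbb{F}$ (of arbitrary, possibly infinite, dimension) is a non-Abelian Lie algebra that contains a codimension 1 Abelian subalgebra. A Lie algebra is decomposable if it is the direct sum of two commuting nonzero Lie subalgebras; otherwise it is indecomposable. Here $\oplus$ denotes the Lie algebra direct sum. The block form of a linear map $\phi:\mathbf{L}\to\mathbf{L}$ is with respect to $\mathbf{L}=\mathbf{L}_0\oplus\mathbf{W}$: $\phi(X+Y)=(\phi_{00}X+\phi_{01}Y)+(\phi_{10}X+\phi_{11}Y)$ for $X\in\mathbf{L}_0$, $Y\in\mathbf{W}$, with linear maps $\phi_{00}:\mathbf{L}_0\to\mathbf{L}_0$, $\phi_{01}:\mathbf{W}\to\mathbf{L}_0$, $\phi_{10}:\mathbf{L}_0\to\mathbf{W}$, $\phi_{11}:\mathbf{W}\to\mathbf{W}$.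 *)

theory Defs
  imports Complex_Main "HOL-Algebra.Bij"
begin

locale lie_algebra = vector_space scale
  for scale :: "'f::field \<Rightarrow> 'v::ab_group_add \<Rightarrow> 'v" +
  fixes bracket :: "'v \<Rightarrow> 'v \<Rightarrow> 'v"
  assumes linear_left: "Vector_Spaces.linear scale scale (\<lambda>x. bracket x y)"
    and linear_right: "Vector_Spaces.linear scale scale (bracket x)"
    and alternating: "bracket x x = 0"
    and jacobi: "bracket x (bracket y z) + bracket y (bracket z x) + bracket z (bracket x y) = 0"
begin

text \<open>The predicates below take the carrier of a subalgebra as an argument, so that they apply
  both to the ambient Lie algebra (carrier \<^term>\<open>UNIV\<close>) and to its subalgebras, regarded as
  Lie algebras with the restricted operations.\<close>

definition lie_subalgebra :: "'v set \<Rightarrow> bool" where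
  "lie_subalgebra S \<longleftrightarrow> subspace S \<and> (\<forall>x\<in>S. \<forall>y\<in>S. bracket x y \<in> S)"

definition abelian :: "'v set \<Rightarrow> bool" where
  "abelian S \<longleftrightarrow> (\<forall>x\<in>S. \<forall>y\<in>S. bracket x y = 0)"

definition direct_sum :: "'v set \<Rightarrow> 'v set \<Rightarrow> 'v set \<Rightarrow> bool" where
  "direct_sum S A B \<longleftrightarrow>
    subspace A \<and> subspace B \<and> A \<inter> B = {0} \<and> S = {a + b | a b. a \<in> A \<and> b \<in> B}"

text \<open>Codimension is the dimension of a linear complement.  Since \<^term>\<open>dim\<close> is \<open>0\<close> on
  infinite-dimensional spaces, \<open>dim C = 1\<close> does say that \<open>C\<close> is a line.\<close>

definition codim_one :: "'v set \<Rightarrow> 'v set \<Rightarrow> bool" where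
  "codim_one S A \<longleftrightarrow> (\<exists>C. direct_sum S A C \<and> dim C = 1)"

definition almost_abelian :: "'v set \<Rightarrow> bool" where
  "almost_abelian S \<longleftrightarrow> lie_subalgebra S \<and> \<not> abelian S \<and>
    (\<exists>A. lie_subalgebra A \<and> abelian A \<and> codim_one S A)"

definition lie_direct_sum :: "'v set \<Rightarrow> 'v set \<Rightarrow> 'v set \<Rightarrow> bool" where
  "lie_direct_sum S A B \<longleftrightarrow> lie_subalgebra A \<and> lie_subalgebra B \<and> direct_sum S A B \<and>
    (\<forall>a\<in>A. \<forall>b\<in>B. bracket a b = 0)"

definition indecomposable :: "'v set \<Rightarrow> bool" where
  "indecomposable S \<longleftrightarrow> \<not> (\<exists>A B. A \<noteq> {0} \<and> B \<noteq> {0} \<and> lie_direct_sum S A B)"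

definition linear_map :: "'v set \<Rightarrow> 'v set \<Rightarrow> ('v \<Rightarrow> 'v) \<Rightarrow> bool" where
  "linear_map S T f \<longleftrightarrow> f \<in> S \<rightarrow> T \<and> (\<forall>x\<in>S. \<forall>y\<in>S. f (x + y) = f x + f y) \<and>
    (\<forall>c. \<forall>x\<in>S. f (scale c x) = scale c (f x))"

definition lie_hom :: "'v set \<Rightarrow> 'v set \<Rightarrow> ('v \<Rightarrow> 'v) \<Rightarrow> bool" where
  "lie_hom S T f \<longleftrightarrow> linear_map S T f \<and>
    (\<forall>x\<in>S. \<forall>y\<in>S. f (bracket x y) = bracket (f x) (f y))"

text \<open>As in \<^const>\<open>AutoGroup\<close>, automorphisms of \<open>S\<close> are represented by functions that are
  \<^const>\<open>undefined\<close> outside \<open>S\<close>; on \<^term>\<open>UNIV\<close> this is no restriction.\<close>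

definition lie_Aut :: "'v set \<Rightarrow> ('v \<Rightarrow> 'v) monoid" where
  "lie_Aut S = BijGroup S \<lparr>carrier := {f \<in> Bij S. lie_hom S S f}\<rparr>"

definition block_form ::
  "'v set \<Rightarrow> 'v set \<Rightarrow> ('v \<Rightarrow> 'v) \<Rightarrow>
   ('v \<Rightarrow> 'v) \<Rightarrow> ('v \<Rightarrow> 'v) \<Rightarrow> ('v \<Rightarrow> 'v) \<Rightarrow> ('v \<Rightarrow> 'v) \<Rightarrow> bool" where
  "block_form U W f f00 f01 f10 f11 \<longleftrightarrow>
    linear_map U U f00 \<and> linear_map W U f01 \<and> linear_map U W f10 \<and> linear_map W W f11 \<and>
    (\<forall>x\<in>U. \<forall>y\<in>W. f (x + y) = (f00 x + f01 y) + (f10 x + f11 y))"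

lemma group_lie_Aut:
  assumes "lie_subalgebra S"
  shows "group (lie_Aut S)"
proof -
  have sub: "x \<in> S \<Longrightarrow> y \<in> S \<Longrightarrow> x + y \<in> S" "x \<in> S \<Longrightarrow> scale c x \<in> S"
    "x \<in> S \<Longrightarrow> y \<in> S \<Longrightarrow> bracket x y \<in> S" for x y c
    using assms by (auto simp: lie_subalgebra_def subspace_def)
  have "subgroup {f \<in> Bij S. lie_hom S S f} (BijGroup S)"
  proof (rule group.subgroupI[OF group_BijGroup])
    show "{f \<in> Bij S. lie_hom S S f} \<subseteq> carrier (BijGroup S)"
      by (auto simp: BijGroup_def)
    have "lie_hom S S (\<lambda>x\<in>S. x)"
      using sub by (auto simp: lie_hom_def linear_map_def)
    then show "{f \<in> Bij S. lie_hom S S f} \<noteq> {}"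
      using id_Bij by blast
  next
    fix f assume "f \<in> {f \<in> Bij S. lie_hom S S f}"
    then have f: "f \<in> Bij S" "lie_hom S S f" by auto
    then have b: "bij_betw f S S" by (simp add: Bij_def)
    define g where "g = inv_into S f"
    have g: "g x \<in> S" "f (g x) = x" if "x \<in> S" for x
      using b that by (auto simp: g_def bij_betw_def inv_into_into f_inv_into_f)
    have gf: "g (f x) = x" if "x \<in> S" for x
      using b that by (auto simp: g_def bij_betw_def)
    have eq: "g z = w" if "w \<in> S" "f w = z" for z w
      using gf that by auto
    have "lie_hom S S (\<lambda>x\<in>S. g x)"
      unfolding lie_hom_def linear_map_def
      using f(2) sub g by (auto simp: lie_hom_def linear_map_def intro!: eq)
    then show "inv\<^bsub>BijGroup S\<^esub> f \<in> {f \<in> Bij S. lie_hom S S f}"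
      using f(1) by (simp add: inv_BijGroup restrict_inv_into_Bij g_def)
  next
    fix f g assume "f \<in> {f \<in> Bij S. lie_hom S S f}" "g \<in> {f \<in> Bij S. lie_hom S S f}"
    then have "f \<in> Bij S" "g \<in> Bij S" "lie_hom S S (compose S f g)"
      using sub by (auto simp: lie_hom_def linear_map_def compose_def Pi_iff)
    then show "f \<otimes>\<^bsub>BijGroup S\<^esub> g \<in> {f \<in> Bij S. lie_hom S S f}"
      by (simp add: BijGroup_def compose_Bij)
  qed
  then show ?thesis
    unfolding lie_Aut_def by (rule subgroup.subgroup_is_group[OF _ group_BijGroup])
qed

end

end

theory Submission
  imports Defs
begin

text \<open>
  Let \<open>Z\<close> denote the centre and \<open>D\<close> the derived algebra.  The only consequence of
  indecomposability that matters is \<open>Z(L0) \<subseteq> D(L0)\<close>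
  (\<open>center_subset_derived_if_indecomposable\<close>): a central element outside \<open>D(L0)\<close> spans a direct
  factor, whose complement can be any hyperplane that contains \<open>D(L0)\<close>.

  Since \<open>W\<close> is central, \<open>D(L) = D(L0)\<close> and \<open>Z(L) = Z(L0) \<oplus> W\<close>.  A surjective endomorphism \<open>\<phi>\<close>
  of \<open>L\<close> maps \<open>D(L)\<close> onto itself and \<open>Z(L)\<close> into itself.  In terms of blocks this says that
  \<open>\<phi>10\<close> vanishes on \<open>D(L0)\<close>, hence on \<open>Z(L0)\<close>, and that \<open>\<phi>01\<close> takes values in \<open>Z(L0)\<close>, hence in
  \<open>D(L0)\<close>.  So the off-diagonal blocks interact with the diagonal ones only through a subspace that
  \<open>\<phi>\<close> preserves, and this makes injectivity of \<open>\<phi>\<close> a condition on the diagonal blocks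
  (\<open>bij_hom_diagonal\<close> and \<open>surj_hom_bij\<close>).  No dimension count occurs, so infinite dimension is
  harmless; but there injectivity of the blocks does not give surjectivity (a shift on \<open>W\<close>),
  which is why surjectivity of \<open>\<phi>\<close> is a separate condition.
\<close>

section \<open>Centre and derived algebra\<close>

context lie_algebra
begin

lemma bracket_add_left: "bracket (x + y) z = bracket x z + bracket y z"
  using linear_left[of z] by (simp add: Vector_Spaces.linear_iff)

lemma bracket_add_right: "bracket z (x + y) = bracket z x + bracket z y"
  using linear_right[of z] by (simp add: Vector_Spaces.linear_iff)

lemma bracket_scale_left: "bracket (scale c x) z = scale c (bracket x z)"
  using linear_left[of z] by (simp add: Vector_Spaces.linear_iff)

lemma bracket_scale_right: "bracket z (scale c x) = scale c (bracket z x)"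
  using linear_right[of z] by (simp add: Vector_Spaces.linear_iff)

lemma bracket_uminus_left: "bracket (- x) z = - bracket x z"
  using bracket_scale_left[of "- 1" x z] by simp

lemma bracket_swap_zero:
  assumes "bracket x y = 0"
  shows "bracket y x = 0"
  using alternating[of "x + y"] alternating[of x] alternating[of y] assms
  by (simp add: bracket_add_left bracket_add_right)

definition center :: "'v set \<Rightarrow> 'v set" where
  "center S = {z \<in> S. \<forall>x\<in>S. bracket z x = 0}"

definition derived :: "'v set \<Rightarrow> 'v set" where
  "derived S = span {bracket x y | x y. x \<in> S \<and> y \<in> S}"

lemma bracket_in_derived: "x \<in> S \<Longrightarrow> y \<in> S \<Longrightarrow> bracket x y \<in> derived S"
  unfolding derived_def by (rule span_base) auto

lemma derived_subset: "lie_subalgebra S \<Longrightarrow> derived S \<subseteq> S"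
  unfolding derived_def lie_subalgebra_def by (intro span_minimal) auto

text \<open>A basis of \<open>D(S)\<close> stays independent after adding a central \<open>z \<notin> D(S)\<close>, and so extends to a
  basis of \<open>S\<close> through \<open>z\<close>.  The other basis vectors span a hyperplane \<open>H \<supseteq> D(S)\<close>, which is
  thereby an ideal complementary to the line of \<open>z\<close>; it is nonzero since \<open>S\<close> is non-Abelian.\<close>

lemma center_subset_derived_if_indecomposable:
  assumes S: "lie_subalgebra S" and nonabelian: "\<not> abelian S" and indec: "indecomposable S"
  shows "center S \<subseteq> derived S"
proof
  fix z assume z: "z \<in> center S"
  show "z \<in> derived S"
  proof (rule ccontr)
    assume notin: "z \<notin> derived S"
    have subS: "subspace S" using S by (simp add: lie_subalgebra_def)
    have zS: "z \<in> S" and zc: "\<And>x. x \<in> S \<Longrightarrow> bracket z x = 0" using z by (auto simp: center_def)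
    obtain B where B: "B \<subseteq> derived S" "independent B" "derived S \<subseteq> span B"
      using maximal_independent_subset by blast
    have spanB: "span B \<subseteq> derived S"
      using B(1) by (simp add: derived_def span_minimal)
    have "independent (insert z B)"
      using B(2) notin spanB by (intro independent_insertI) auto
    moreover have "insert z B \<subseteq> S" using B(1) derived_subset[OF S] zS by auto
    ultimately obtain C where C: "insert z B \<subseteq> C" "C \<subseteq> S" "independent C" "S \<subseteq> span C"
      using maximal_independent_subset_extend by blast
    define H where "H = span (C - {z})"
    have subH: "subspace H" by (simp add: H_def)
    have HS: "H \<subseteq> S" unfolding H_def using C(2) subS by (intro span_minimal) auto
    have "z \<notin> B" using B(1) notin by auto
    then have "span B \<subseteq> H" unfolding H_def using C(1) by (intro span_mono) auto
    then have DH: "derived S \<subseteq> H" using B(3) by auto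
    have zH: "z \<notin> H" using C(1,3) unfolding H_def dependent_def by auto
    have lieH: "lie_subalgebra H"
      unfolding lie_subalgebra_def using subH DH HS bracket_in_derived by blast
    have lieZ: "lie_subalgebra (span {z})"
      using subspace_span[of "{z}"]
      by (auto simp: lie_subalgebra_def span_singleton bracket_scale_left bracket_scale_right
          alternating intro!: range_eqI[of _ _ 0])
    have meet: "H \<inter> span {z} = {0}"
    proof -
      have "scale c z = 0" if "scale c z \<in> H" for c
        using subspace_scale[OF subH that, of "inverse c"] zH by (cases "c = 0") auto
      then show ?thesis using subspace_0[OF subH] span_zero by (auto simp: span_singleton)
    qed
    have decomp: "S = {a + b | a b. a \<in> H \<and> b \<in> span {z}}"
    proof
      show "{a + b | a b. a \<in> H \<and> b \<in> span {z}} \<subseteq> S"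
        using HS zS subS by (auto simp: span_singleton intro: subspace_add subspace_scale)
      show "S \<subseteq> {a + b | a b. a \<in> H \<and> b \<in> span {z}}"
      proof
        fix x assume "x \<in> S"
        then have "x \<in> span (insert z (C - {z}))" using C(1,4) by (auto simp: insert_absorb)
        then obtain k where "x - scale k z \<in> H" unfolding H_def span_insert by auto
        moreover have "x = (x - scale k z) + scale k z" by simp
        ultimately show "x \<in> {a + b | a b. a \<in> H \<and> b \<in> span {z}}"
          unfolding span_singleton by blast
      qed
    qed
    have comm: "\<forall>a\<in>H. \<forall>b\<in>span {z}. bracket a b = 0"
      using HS zc bracket_swap_zero by (auto simp: span_singleton bracket_scale_right)
    have "lie_direct_sum S H (span {z})"
      using lieH lieZ meet decomp comm subH by (auto simp: lie_direct_sum_def direct_sum_def)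
    moreover have "H \<noteq> {0}"
    proof
      assume "H = {0}"
      then have "abelian S" using DH bracket_in_derived by (auto simp: abelian_def)
      then show False using nonabelian by simp
    qed
    moreover have "span {z} \<noteq> {0}"
      using zH subspace_0[OF subH] span_base[of z "{z}"] by auto
    ultimately show False using indec by (auto simp: indecomposable_def)
  qed
qed

section \<open>Endomorphisms\<close>

lemma lie_hom_UNIV_iff:
  "lie_hom UNIV UNIV f \<longleftrightarrow>
    Vector_Spaces.linear scale scale f \<and> (\<forall>x y. f (bracket x y) = bracket (f x) (f y))"
  using vector_space_axioms by (auto simp: lie_hom_def linear_map_def Vector_Spaces.linear_iff)

lemma image_derived:
  assumes "lie_hom UNIV UNIV f"
  shows "f ` derived S = derived (f ` S)"
proof -
  from assms have lin: "Vector_Spaces.linear scale scale f"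
    and br: "\<And>x y. f (bracket x y) = bracket (f x) (f y)"
    by (auto simp: lie_hom_UNIV_iff)
  interpret f: Vector_Spaces.linear scale scale f by (rule lin)
  have "f ` {bracket x y | x y. x \<in> S \<and> y \<in> S} = {bracket x y | x y. x \<in> f ` S \<and> y \<in> f ` S}"
  proof (intro subset_antisym subsetI)
    fix v assume "v \<in> {bracket x y | x y. x \<in> f ` S \<and> y \<in> f ` S}"
    then obtain x y where "x \<in> S" "y \<in> S" "v = f (bracket x y)" by (auto simp: br)
    then show "v \<in> f ` {bracket x y | x y. x \<in> S \<and> y \<in> S}" by blast
  next
    fix v assume "v \<in> f ` {bracket x y | x y. x \<in> S \<and> y \<in> S}"
    then obtain x y where "x \<in> S" "y \<in> S" "v = bracket (f x) (f y)" by (auto simp: br)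
    then show "v \<in> {bracket x y | x y. x \<in> f ` S \<and> y \<in> f ` S}" by blast
  qed
  then show ?thesis unfolding derived_def f.span_image[symmetric] by simp
qed

lemma surj_lie_hom_center:
  assumes "lie_hom UNIV UNIV f" "surj f" "z \<in> center UNIV"
  shows "f z \<in> center UNIV"
proof -
  have f: "Vector_Spaces.linear scale scale f" "\<And>x y. f (bracket x y) = bracket (f x) (f y)"
    using assms(1) by (auto simp: lie_hom_UNIV_iff)
  interpret f: Vector_Spaces.linear scale scale f by (rule f(1))
  have "bracket (f z) (f x) = 0" for x
    using assms(3) f(2)[of z x] by (simp add: center_def f.zero)
  then show ?thesis using assms(2) unfolding center_def by (smt (verit) mem_Collect_eq surjD UNIV_I)
qed

end

section \<open>Splitting off an Abelian factor\<close>

text \<open>The condition \<open>center L0 \<subseteq> derived L0\<close> stands in for indecomposability of \<open>L0\<close>; the whole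
  description of the automorphisms follows from it.\<close>

locale abelian_factor = lie_algebra scale bracket
  for scale :: "'f::field \<Rightarrow> 'v::ab_group_add \<Rightarrow> 'v"
    and bracket :: "'v \<Rightarrow> 'v \<Rightarrow> 'v" +
  fixes L0 W :: "'v set"
  assumes decomposition: "lie_direct_sum UNIV L0 W"
    and abelian_W: "abelian W"
    and center_L0: "center L0 \<subseteq> derived L0"
begin

definition proj :: "'v \<Rightarrow> 'v" where
  "proj x = (SOME a. a \<in> L0 \<and> x - a \<in> W)"

lemma subspace_L0: "subspace L0" and subspace_W: "subspace W" and meet: "L0 \<inter> W = {0}"
  and lie_L0: "lie_subalgebra L0" and commute: "x \<in> L0 \<Longrightarrow> y \<in> W \<Longrightarrow> bracket x y = 0"
  using decomposition by (auto simp: lie_direct_sum_def direct_sum_def)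

lemma proj_in: "proj x \<in> L0" and proj_compl: "x - proj x \<in> W"
proof -
  have "x \<in> {a + b | a b. a \<in> L0 \<and> b \<in> W}"
    using decomposition by (auto simp: lie_direct_sum_def direct_sum_def)
  then obtain a b where "x = a + b" "a \<in> L0" "b \<in> W" by auto
  then have "\<exists>a. a \<in> L0 \<and> x - a \<in> W" by (intro exI[of _ a]) simp
  from someI_ex[OF this] show "proj x \<in> L0" "x - proj x \<in> W" by (auto simp: proj_def)
qed

lemma proj_eqI:
  assumes "a \<in> L0" "x - a \<in> W"
  shows "proj x = a"
proof -
  have "proj x - a \<in> L0" using assms(1) proj_in subspace_L0 by (simp add: subspace_diff)
  moreover have "proj x - a = (x - a) - (x - proj x)" by simp
  then have "proj x - a \<in> W" using assms(2) proj_compl subspace_W by (metis subspace_diff)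
  ultimately have "proj x - a = 0" using meet by blast
  then show ?thesis by simp
qed

lemma proj_L0: "x \<in> L0 \<Longrightarrow> proj x = x"
  using subspace_0[OF subspace_W] by (simp add: proj_eqI)

lemma in_W_if_proj_zero: "proj x = 0 \<Longrightarrow> x \<in> W"
  using proj_compl[of x] by simp

lemma W_subset_center: "W \<subseteq> center UNIV"
proof
  fix y assume y: "y \<in> W"
  have "bracket y x = 0" for x
  proof -
    have "bracket y x = bracket y (proj x) + bracket y (x - proj x)"
      by (simp flip: bracket_add_right)
    also have "\<dots> = 0"
      using y abelian_W commute[OF proj_in y] proj_compl
      by (simp add: abelian_def bracket_swap_zero)
    finally show ?thesis .
  qed
  then show "y \<in> center UNIV" by (simp add: center_def)
qed

lemma bracket_proj: "bracket (proj x) (proj y) = bracket x y"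
proof -
  have W0: "bracket w u = 0" "bracket u w = 0" if "w \<in> W" for w u
    using that W_subset_center bracket_swap_zero by (auto simp: center_def)
  have "bracket x y = bracket (proj x + (x - proj x)) (proj y + (y - proj y))" by simp
  also have "\<dots> = bracket (proj x) (proj y)"
    by (simp only: bracket_add_left bracket_add_right W0 proj_compl) simp
  finally show ?thesis by simp
qed

lemma proj_hom: "lie_hom UNIV UNIV proj"
proof -
  have "proj (x + y) = proj x + proj y" for x y
  proof (rule proj_eqI)
    show "proj x + proj y \<in> L0" by (simp add: proj_in subspace_L0 subspace_add)
    have "x + y - (proj x + proj y) = (x - proj x) + (y - proj y)" by simp
    then show "x + y - (proj x + proj y) \<in> W"
      using proj_compl subspace_W by (metis subspace_add)
  qed
  moreover have "proj (scale c x) = scale c (proj x)" for c x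
  proof (rule proj_eqI)
    show "scale c (proj x) \<in> L0" by (simp add: proj_in subspace_L0 subspace_scale)
    show "scale c x - scale c (proj x) \<in> W"
      using proj_compl subspace_W by (simp add: subspace_scale flip: scale_right_diff_distrib)
  qed
  moreover have "proj (bracket x y) = bracket (proj x) (proj y)" for x y
  proof -
    have "bracket (proj x) (proj y) \<in> L0" using lie_L0 proj_in by (auto simp: lie_subalgebra_def)
    then show ?thesis using proj_L0 by (simp add: bracket_proj)
  qed
  ultimately show ?thesis by (auto simp: lie_hom_def linear_map_def)
qed

lemma derived_UNIV: "derived UNIV = derived L0"
proof -
  have "{bracket x y | x y. x \<in> UNIV \<and> y \<in> UNIV} = {bracket x y | x y. x \<in> L0 \<and> y \<in> L0}"
    using bracket_proj proj_in by (intro Collect_cong) (metis UNIV_I)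
  then show ?thesis by (simp add: derived_def)
qed

text \<open>Applied to \<open>z = \<phi> y\<close> with \<open>y \<in> W\<close>, this says that \<open>\<phi>01\<close> takes values in \<open>D(L0)\<close>.\<close>

lemma proj_center_in_derived:
  assumes "z \<in> center UNIV"
  shows "proj z \<in> derived L0"
proof -
  have "proj z \<in> center L0"
    using assms proj_in[of z] bracket_proj[of z] proj_L0 by (simp add: center_def) metis
  then show ?thesis using center_L0 by auto
qed

text \<open>\<open>\<phi>10\<close> vanishes on the central elements of
  \<open>L0\<close>, because these lie in \<open>D(L)\<close> and \<open>\<phi>\<close> maps \<open>D(L)\<close> into \<open>D(L) \<subseteq> L0\<close>.\<close>

lemma hom_center_L0:
  assumes "lie_hom UNIV UNIV f" "x \<in> L0" "x \<in> center UNIV"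
  shows "f x \<in> L0"
proof -
  have "x \<in> derived UNIV" using proj_center_in_derived[OF assms(3)] assms(2)
    by (simp add: proj_L0 derived_UNIV)
  moreover have "f ` derived UNIV \<subseteq> derived UNIV"
    unfolding image_derived[OF assms(1)] unfolding derived_def by (intro span_mono) auto
  ultimately have "f x \<in> derived L0" unfolding derived_UNIV by auto
  then show ?thesis using derived_subset[OF lie_L0] by auto
qed

text \<open>Both diagonal blocks are injective because an element of the kernel ends up in \<open>L0 \<inter> W = 0\<close>,
  either itself or its image.  If \<open>\<phi>00 x = 0\<close>,
  then \<open>\<phi> x \<in> W\<close> is central, so \<open>x\<close> is central and \<open>\<phi> x \<in> L0\<close>.  If \<open>\<phi>11 y = 0\<close>, then \<open>\<phi> y\<close> is a
  central element of \<open>L0\<close>, so it lies in \<open>D(L0) = \<phi> D(L0)\<close> and \<open>y \<in> L0\<close>.  Surjectivity of \<open>\<phi>00\<close>: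
  \<open>L0\<close> is the sum of the images of \<open>\<phi>00\<close> and \<open>\<phi>01\<close>, and the latter is contained in
  \<open>D(L0) = \<phi>00 D(L0)\<close>.\<close>

lemma bij_hom_diagonal:
  assumes hom: "lie_hom UNIV UNIV f" and "bij f"
  shows "bij_betw (proj \<circ> f) L0 L0" and "{y \<in> W. f y - proj (f y) = 0} = {0}"
proof -
  have surj: "surj f" and inj: "inj f" using \<open>bij f\<close> by (auto simp: bij_def)
  have lin: "Vector_Spaces.linear scale scale f" and linp: "Vector_Spaces.linear scale scale proj"
    and br: "\<And>x y. f (bracket x y) = bracket (f x) (f y)"
    using hom proj_hom by (auto simp: lie_hom_UNIV_iff)
  interpret f: Vector_Spaces.linear scale scale f by (rule lin)
  interpret p: Vector_Spaces.linear scale scale proj by (rule linp)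
  have f_derived: "f ` derived L0 = derived L0"
    using image_derived[OF hom, of UNIV] surj by (simp add: derived_UNIV)
  have inj_diag: "x = 0" if x: "x \<in> L0" "proj (f x) = 0" for x
  proof -
    have fx: "f x \<in> W" using x(2) by (rule in_W_if_proj_zero)
    have "f (bracket x u) = 0" for u using fx W_subset_center by (auto simp: br center_def)
    then have "bracket x u = 0" for u using inj f.zero by (metis injD)
    then have "x \<in> center UNIV" by (simp add: center_def)
    then have "f x \<in> L0" by (rule hom_center_L0[OF hom x(1)])
    then have "f x = 0" using fx meet by auto
    then show "x = 0" using inj f.zero by (metis injD)
  qed
  have "inj_on (proj \<circ> f) L0"
  proof (rule inj_onI)
    fix x y assume xy: "x \<in> L0" "y \<in> L0" "(proj \<circ> f) x = (proj \<circ> f) y"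
    have "x - y = 0"
      by (rule inj_diag) (use xy subspace_L0 in \<open>simp_all add: subspace_diff f.diff p.diff\<close>)
    then show "x = y" by simp
  qed
  moreover have "L0 \<subseteq> (proj \<circ> f) ` L0"
  proof
    fix x assume x: "x \<in> L0"
    obtain u where u: "x = f u" using surj by auto
    \<comment> \<open>The \<open>W\<close>-component of \<open>u\<close> contributes only an element of \<open>D(L0)\<close>, which already comes
      from some \<open>d \<in> D(L0)\<close>.\<close>
    have "u - proj u \<in> center UNIV" using W_subset_center proj_compl by auto
    then have "f (u - proj u) \<in> center UNIV" by (rule surj_lie_hom_center[OF hom surj])
    then have "proj (f (u - proj u)) \<in> derived L0" by (rule proj_center_in_derived)
    then obtain d where d: "d \<in> derived L0" "proj (f (u - proj u)) = f d"
      using f_derived by auto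
    have dL: "d \<in> L0" "f d \<in> L0" using d(1) f_derived derived_subset[OF lie_L0] by auto
    have "x = proj (f (proj u + (u - proj u)))" using u x proj_L0 by simp
    also have "\<dots> = proj (f (proj u)) + f d" unfolding f.add p.add d(2) ..
    also have "\<dots> = (proj \<circ> f) (proj u + d)" using dL proj_L0 by (simp add: f.add p.add)
    finally show "x \<in> (proj \<circ> f) ` L0"
      using proj_in dL(1) subspace_L0 by (metis imageI subspace_add)
  qed
  ultimately show "bij_betw (proj \<circ> f) L0 L0" using proj_in by (auto simp: bij_betw_def)
  have "y = 0" if y: "y \<in> W" "f y - proj (f y) = 0" for y
  proof -
    have "f y \<in> center UNIV" using y(1) W_subset_center by (auto intro: surj_lie_hom_center[OF hom surj])
    then have "f y \<in> f ` derived L0"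
      using proj_center_in_derived[of "f y"] y(2) by (simp add: f_derived)
    then have "y \<in> L0" using inj derived_subset[OF lie_L0] by (auto simp: inj_image_mem_iff)
    then show "y = 0" using y(1) meet by auto
  qed
  then show "{y \<in> W. f y - proj (f y) = 0} = {0}"
    using subspace_0[OF subspace_W] by (auto simp: f.zero p.zero)
qed

text \<open>Let \<open>v = x + y\<close> be in the kernel.  Then \<open>\<phi> x = - \<phi> y\<close> is central because \<open>y\<close> is, and injectivity of
  \<open>\<phi>00\<close> makes \<open>x\<close> central, so that \<open>\<phi> x \<in> L0\<close>.  Thus \<open>\<phi>11 y = 0\<close>, which gives \<open>y = 0\<close> and then
  \<open>x = 0\<close>.\<close>

lemma surj_hom_bij:
  assumes hom: "lie_hom UNIV UNIV f" and surj: "surj f"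
    and inj00: "inj_on (proj \<circ> f) L0"
    and ker11: "{y \<in> W. f y - proj (f y) = 0} = {0}"
  shows "bij f"
proof -
  have lin: "Vector_Spaces.linear scale scale f" and linp: "Vector_Spaces.linear scale scale proj"
    and br: "\<And>x y. f (bracket x y) = bracket (f x) (f y)"
    using hom proj_hom by (auto simp: lie_hom_UNIV_iff)
  interpret f: Vector_Spaces.linear scale scale f by (rule lin)
  interpret p: Vector_Spaces.linear scale scale proj by (rule linp)
  have "v = 0" if v: "f v = 0" for v
  proof -
    define x y where "x = proj v" and "y = v - proj v"
    have x: "x \<in> L0" and y: "y \<in> W" and xy: "v = x + y"
      using proj_in proj_compl by (auto simp: x_def y_def)
    have sum0: "f x = - f y" using v by (simp add: xy f.add eq_neg_iff_add_eq_0)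
    have fy: "f y \<in> center UNIV"
      using y W_subset_center by (auto intro: surj_lie_hom_center[OF hom surj])
    have "bracket x u = 0" for u
    proof -
      have "f (bracket x u) = 0"
        using fy by (simp add: br sum0 center_def bracket_uminus_left)
      moreover have "bracket x u \<in> L0"
        using lie_L0 x proj_in bracket_proj[of x u] proj_L0[OF x] by (metis lie_subalgebra_def)
      ultimately show ?thesis
        using inj00 subspace_0[OF subspace_L0] inj_onD[of "proj \<circ> f" L0 "bracket x u" 0]
        by (simp add: f.zero)
    qed
    then have "x \<in> center UNIV" by (simp add: center_def)
    then have "f x \<in> L0" by (rule hom_center_L0[OF hom x])
    then have "f y \<in> L0" using sum0 subspace_L0 by (metis minus_minus subspace_neg)
    then have y0: "y = 0" using ker11 y proj_L0 by auto
    then have "(proj \<circ> f) x = (proj \<circ> f) 0" using sum0 by (simp add: f.zero)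
    then have "x = 0" using inj00 x subspace_0[OF subspace_L0] by (meson inj_onD)
    then show "v = 0" using xy y0 by simp
  qed
  then have "inj f" by (simp add: f.inj_iff_eq_0)
  then show ?thesis using surj by (simp add: bij_def)
qed

text \<open>Only the values of a block on its own summand matter, so \<open>\<phi>00\<close> can be chosen
  \<^const>\<open>undefined\<close> outside \<open>L0\<close>, as membership in \<open>Aut(L0)\<close> requires.\<close>

lemma block_form_blocks:
  assumes hom: "lie_hom UNIV UNIV f"
  shows "block_form L0 W f (restrict (proj \<circ> f) L0) (proj \<circ> f)
    (\<lambda>x. f x - proj (f x)) (\<lambda>x. f x - proj (f x))"
proof -
  have lin: "Vector_Spaces.linear scale scale f" and linp: "Vector_Spaces.linear scale scale proj"
    using hom proj_hom by (auto simp: lie_hom_UNIV_iff)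
  interpret f: Vector_Spaces.linear scale scale f by (rule lin)
  interpret p: Vector_Spaces.linear scale scale proj by (rule linp)
  show ?thesis
    using subspace_L0 proj_in proj_compl
    by (auto simp: block_form_def linear_map_def f.add p.add f.scale p.scale
        subspace_add subspace_scale scale_right_diff_distrib)
qed

lemma block_form_diagonal:
  assumes block: "block_form L0 W f f00 f01 f10 f11" and hom: "lie_hom UNIV UNIV f"
  shows "x \<in> L0 \<Longrightarrow> f00 x = proj (f x)" and "y \<in> W \<Longrightarrow> f11 y = f y - proj (f y)"
proof -
  have maps: "linear_map L0 L0 f00" "linear_map W L0 f01" "linear_map L0 W f10" "linear_map W W f11"
    and f: "\<And>x y. x \<in> L0 \<Longrightarrow> y \<in> W \<Longrightarrow> f (x + y) = (f00 x + f01 y) + (f10 x + f11 y)"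
    using block by (auto simp: block_form_def)
  have zero: "0 \<in> L0" "0 \<in> W" by (simp_all add: subspace_0 subspace_L0 subspace_W)
  have map0: "h 0 = 0" if "linear_map S T h" "0 \<in> S" for S T h
    using that unfolding linear_map_def by (metis scale_zero_left)
  have zeros: "f00 0 = 0" "f01 0 = 0" "f10 0 = 0" "f11 0 = 0"
    using maps zero map0 by blast+
  show "f00 x = proj (f x)" if x: "x \<in> L0"
  proof (rule proj_eqI[symmetric])
    show "f00 x \<in> L0" using maps(1) x by (auto simp: linear_map_def)
    show "f x - f00 x \<in> W" using f[OF x zero(2)] maps(3) x by (auto simp: zeros linear_map_def)
  qed
  show "f11 y = f y - proj (f y)" if y: "y \<in> W"
  proof -
    have fy: "f y = f01 y + f11 y" using f[OF zero(1) y] by (simp add: zeros)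
    have "proj (f y) = f01 y"
      using maps(2,4) y by (intro proj_eqI) (auto simp: fy linear_map_def)
    then show ?thesis by (simp add: fy)
  qed
qed

theorem carrier_lie_Aut_UNIV:
  "carrier (lie_Aut UNIV) =
    {f. lie_hom UNIV UNIV f \<and> surj f \<and>
      (\<exists>f00 f01 f10 f11. block_form L0 W f f00 f01 f10 f11 \<and>
        f00 \<in> carrier (lie_Aut L0) \<and> {y \<in> W. f11 y = 0} = {0})}" (is "_ = ?R")
proof
  show "carrier (lie_Aut UNIV) \<subseteq> ?R"
  proof
    fix f assume "f \<in> carrier (lie_Aut UNIV)"
    then have hom: "lie_hom UNIV UNIV f" and bij: "bij f"
      by (auto simp: lie_Aut_def Bij_def)
    have "bij_betw (restrict (proj \<circ> f) L0) L0 L0"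
      using bij_hom_diagonal(1)[OF hom bij] by simp
    moreover have "lie_hom L0 L0 (restrict (proj \<circ> f) L0)"
    proof -
      have "linear_map L0 L0 (restrict (proj \<circ> f) L0)"
        using block_form_blocks[OF hom] by (simp add: block_form_def)
      then show ?thesis using hom proj_hom lie_L0
        by (auto simp: lie_hom_def lie_subalgebra_def)
    qed
    ultimately have "restrict (proj \<circ> f) L0 \<in> carrier (lie_Aut L0)"
      by (simp add: lie_Aut_def Bij_def)
    then show "f \<in> ?R"
      using hom bij block_form_blocks[OF hom] bij_hom_diagonal(2)[OF hom bij]
      by (auto simp only: bij_def mem_Collect_eq intro!: exI conjI)
  qed
  show "?R \<subseteq> carrier (lie_Aut UNIV)"
  proof
    fix f assume "f \<in> ?R"
    then obtain f00 f01 f10 f11 where hom: "lie_hom UNIV UNIV f" and surj: "surj f"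
      and block: "block_form L0 W f f00 f01 f10 f11"
      and aut: "f00 \<in> carrier (lie_Aut L0)" and ker: "{y \<in> W. f11 y = 0} = {0}" by auto
    have "inj_on f00 L0" using aut by (auto simp: lie_Aut_def Bij_def bij_betw_def)
    then have "inj_on (proj \<circ> f) L0"
      using block_form_diagonal(1)[OF block hom] by (simp add: inj_on_def)
    moreover have "{y \<in> W. f y - proj (f y) = 0} = {0}"
      using ker block_form_diagonal(2)[OF block hom] by (simp cong: conj_cong)
    ultimately have "bij f" using hom surj by (intro surj_hom_bij)
    then show "f \<in> carrier (lie_Aut UNIV)"
      using hom by (simp add: lie_Aut_def Bij_def)
  qed
qed

end

section \<open>Indecomposable almost Abelian factors\<close>

theorem proposition7:
  fixes scale :: "'f::field \<Rightarrow> 'v::ab_group_add \<Rightarrow> 'v"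
    and bracket :: "'v \<Rightarrow> 'v \<Rightarrow> 'v"
    and L0 W :: "'v set"
  assumes "lie_algebra scale bracket"
    and "lie_algebra.almost_abelian scale bracket UNIV"
    and "lie_algebra.lie_direct_sum scale bracket UNIV L0 W"
    and "lie_algebra.almost_abelian scale bracket L0"
    and "lie_algebra.indecomposable scale bracket L0"
    and "lie_algebra.abelian bracket W"
  shows "carrier (lie_algebra.lie_Aut scale bracket UNIV) =
    {\<phi>. lie_algebra.lie_hom scale bracket UNIV UNIV \<phi> \<and> surj \<phi> \<and>
      (\<exists>\<phi>00 \<phi>01 \<phi>10 \<phi>11. lie_algebra.block_form scale L0 W \<phi> \<phi>00 \<phi>01 \<phi>10 \<phi>11 \<and>
        \<phi>00 \<in> carrier (lie_algebra.lie_Aut scale bracket L0) \<and>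
        {Y \<in> W. \<phi>11 Y = 0} = {0})}"
proof -
  interpret lie_algebra scale bracket by (rule assms(1))
  have "center L0 \<subseteq> derived L0"
    using assms(4,5) by (intro center_subset_derived_if_indecomposable) (auto simp: almost_abelian_def)
  then interpret abelian_factor scale bracket L0 W
    using assms(3,6) by unfold_locales
  show ?thesis by (rule carrier_lie_Aut_UNIV)
qed

end
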